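(* Let $Q^f$ be a kernel operator on $\mathcal{X}$ satisfying Assumptions 1, 2 and 3, let $\Lambda>0$ be its spectral radius on $L^\infty_W(\mathcal{X})$, $\lambda=\log\Lambda$, and let $\mu_f^*$ be the unique fixed point of the Feynman–Kac map $\Phi$ with $\mu_f^*(W)<+\infty$. Then for every $\mu\in\mathcal{P}(\mathcal{X})$ with $\mu(W)<+\infty$, $$\lambda=\lim_{k\to+\infty}\frac1k\log\Big(\mu\big[(Q^f)^k\mathbb{1}\big]\Big),$$ and moreover $\Lambda=\mu_f^*(Q^f\mathbb{1})$.
   Context: $\mathcal{X}$ is a Polish space and $\mathcal{P}(\mathcal{X})$ denotes the set of probability measures on $\mathcal{X}$. A kernel operator $Q^f$ on $\mathcal{X}$ is a map such that for every $x\in\mathcal{X}$, $Q^f(x,\cdot)$ is a positive measure of finite mass, and for every measurable $A\subset\mathcal{X}$, $x\mapsto Q^f(x,A)$ is measurable; one writes $(Q^f\varphi)(x)=\int_{\mathcal{X}}\varphi(y)\,Q^f(x,dy)$, $\mu(\varphi)=\int\varphi\,d\mu$, and $\mathbb{1}$ for the constant function $1$. $(K_n)_{n\geq1}$ is a fixed increasing sequence of compact subsets of $\mathcal{X}$ such that every compact $K\subset\mathcal{X}$ is contained in some $K_m$. For $W:\mathcal{X}\to[1,+\infty)$, $L^\infty_W(\mathcal{X})$ is the Banach space of measurable $\varphi$ with $\|\varphi\|_{L^\infty_W}:=\sup_{x}|\varphi(x)|/W(x)<+\infty$. The one-step Feynman–Kac map is $\Phi(\mu)(\varphi)=\mu(Q^f\varphi)/\mu(Q^f\mathbb{1})$.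 The spectral radius of $Q^f$ on $L^\infty_W$ is $\Lambda=\lim_k\|(Q^f)^k\|^{1/k}$. Assumption 1 (Lyapunov): there exist $W:\mathcal{X}\to[1,+\infty)$ bounded on compact sets and positive sequences $(\gamma_n)_{n\ge1}$, $(b_n)_{n\ge1}$ with $\gamma_n\to0$ such that for all $n\geq1$, $Q^fW\leq \gamma_n W+b_n\mathbb{1}_{K_n}$ pointwise. Assumption 2 (minorization and irreducibility): for each $n\geq1$ there exist $\eta_n\in\mathcal{P}(\mathcal{X})$ and $\alpha_n>0$ such that $Q^f(x,\cdot)\geq\alpha_n\eta_n(\cdot)$ (as measures) for all $x\in K_n$; moreover, for any $n_0\geq1$ and any $\varphi\in L^\infty_W(\mathcal{X})$ with $\varphi\geq0$, if $\eta_n(\varphi)=0$ for all $n\geq n_0$, then $(Q^f\varphi)(x)=0$ for all $x\in\mathcal{X}$. Assumption 3 (local regularity): for every $n\geq1$ and every measurable function $\varphi$ bounded on $K_n$, the function $Q^f(\varphi\mathbb{1}_{K_n})$ is continuous on $K_n$. *)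

theory Defs
  imports "HOL-Probability.Probability"
begin

definition kernel_operator :: "('a::topological_space \<Rightarrow> 'a measure) \<Rightarrow> bool" where
  "kernel_operator Q \<longleftrightarrow>
     (\<forall>x. sets (Q x) = sets borel \<and> finite_measure (Q x)) \<and>
     (\<forall>A\<in>sets borel. (\<lambda>x. emeasure (Q x) A) \<in> borel_measurable borel)"

definition Qop :: "('a \<Rightarrow> 'a measure) \<Rightarrow> ('a \<Rightarrow> real) \<Rightarrow> 'a \<Rightarrow> real" where
  "Qop Q \<phi> x = (\<integral>y. \<phi> y \<partial>Q x)"

definition wnorm :: "('a \<Rightarrow> real) \<Rightarrow> ('a \<Rightarrow> real) \<Rightarrow> real" where
  "wnorm W \<phi> = (SUP x. \<bar>\<phi> x\<bar> / W x)"

definition LinfW :: "('a::topological_space \<Rightarrow> real) \<Rightarrow> ('a \<Rightarrow> real) set" where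
  "LinfW W = {\<phi>. \<phi> \<in> borel_measurable borel \<and> bdd_above (range (\<lambda>x. \<bar>\<phi> x\<bar> / W x))}"

definition opnormW :: "('a::topological_space \<Rightarrow> 'a measure) \<Rightarrow> ('a \<Rightarrow> real) \<Rightarrow> nat \<Rightarrow> real" where
  "opnormW Q W k = Sup {wnorm W ((Qop Q ^^ k) \<phi>) | \<phi>. \<phi> \<in> LinfW W \<and> wnorm W \<phi> \<le> 1}"

definition spectral_radiusW :: "('a::topological_space \<Rightarrow> 'a measure) \<Rightarrow> ('a \<Rightarrow> real) \<Rightarrow> real" where
  "spectral_radiusW Q W = lim (\<lambda>k. opnormW Q W k powr (1 / real k))"

definition FK_map :: "('a::topological_space \<Rightarrow> 'a measure) \<Rightarrow> 'a measure \<Rightarrow> 'a measure" where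
  "FK_map Q \<mu> = measure_of UNIV (sets borel)
     (\<lambda>A. (\<integral>\<^sup>+x. emeasure (Q x) A \<partial>\<mu>) / (\<integral>\<^sup>+x. emeasure (Q x) UNIV \<partial>\<mu>))"

definition prob_measures :: "'a::topological_space measure set" where
  "prob_measures = {\<mu>. prob_space \<mu> \<and> sets \<mu> = sets borel}"

definition compact_exhaustion :: "(nat \<Rightarrow> 'a::topological_space set) \<Rightarrow> bool" where
  "compact_exhaustion K \<longleftrightarrow> incseq K \<and> (\<forall>n. compact (K n)) \<and>
     (\<forall>C. compact C \<longrightarrow> (\<exists>m. C \<subseteq> K m))"

definition lyapunov_assm where
  "lyapunov_assm Q K W \<gamma> b \<longleftrightarrow>
     W \<in> borel_measurable borel \<and> (\<forall>x. W x \<ge> 1) \<and>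
     (\<forall>C. compact C \<longrightarrow> bdd_above (W ` C)) \<and>
     (\<forall>n. \<gamma> n > 0 \<and> b n > 0) \<and> \<gamma> \<longlonglongrightarrow> 0 \<and>
     (\<forall>n x. (\<integral>\<^sup>+y. ennreal (W y) \<partial>Q x) \<le> ennreal (\<gamma> n * W x + b n * indicator (K n) x))"

definition minorization_assm where
  "minorization_assm Q K W \<eta> \<alpha> \<longleftrightarrow>
     (\<forall>n. \<eta> n \<in> prob_measures \<and> \<alpha> n > 0 \<and>
        (\<forall>x\<in>K n. \<forall>A\<in>sets borel. emeasure (Q x) A \<ge> ennreal (\<alpha> n) * emeasure (\<eta> n) A)) \<and>
     (\<forall>n0 \<phi>. \<phi> \<in> LinfW W \<longrightarrow> (\<forall>x. \<phi> x \<ge> 0) \<longrightarrow>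
        (\<forall>n\<ge>n0. (\<integral>\<^sup>+y. ennreal (\<phi> y) \<partial>\<eta> n) = 0) \<longrightarrow>
        (\<forall>x. (\<integral>\<^sup>+y. ennreal (\<phi> y) \<partial>Q x) = 0))"

definition regularity_assm where
  "regularity_assm Q K \<longleftrightarrow>
     (\<forall>n \<phi>. \<phi> \<in> borel_measurable borel \<longrightarrow> bdd_above ((\<lambda>x. \<bar>\<phi> x\<bar>) ` K n) \<longrightarrow>
        continuous_on (K n) (Qop Q (\<lambda>y. \<phi> y * indicator (K n) y)))"

end

theory Submission
  imports Defs
begin

text \<open>Write $P$ for the operator $Q^f$. Suppose that $P^k W / (r^k W)$ is unbounded. The
  normalised partial sums of $\sum_k r^{-k} P^k W$ satisfy $r g_N \le P g_N + \varepsilon_N W$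
  with $\varepsilon_N \to 0$, and their limes superior $h$ is a nonzero function with $P h \ge r
  h$: compactness is replaced by reverse Fatou and Dini's theorem. Irreducibility makes $P h$
  positive, which together with the Lyapunov condition gives $\mu(P^k 1) \ge c\, r^k$ for large
  $k$. Hence for every $r > 0$ either $P^k W \le C r^k W$ for all $k$, or $\mu(P^k 1)$ grows at
  least like $r^k$ for every admissible $\mu$. This dichotomy yields the existence of the limit
  defining $\Lambda$ and the convergence of $\mu(P^k 1)^{1/k}$ to it. For the fixed point,
  $\mu_f^*(P^k 1) = \mu_f^*(P 1)^k$.\<close>

section \<open>Integration against a kernel\<close>

locale finite_kernel =
  fixes Q :: "'a::topological_space \<Rightarrow> 'a measure"
  assumes kernel: "kernel_operator Q"
begin

lemma sets_kernel [measurable_cong, simp]: "sets (Q x) = sets borel"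
  using kernel by (auto simp: kernel_operator_def)

lemma space_kernel [simp]: "space (Q x) = UNIV"
  using sets_eq_imp_space_eq[OF sets_kernel[of x]] by simp

lemma emeasure_kernel_measurable [measurable]:
  "A \<in> sets borel \<Longrightarrow> (\<lambda>x. emeasure (Q x) A) \<in> borel_measurable borel"
  using kernel by (auto simp: kernel_operator_def)

lemma kernel_nn_integral_measurable [measurable]:
  assumes "f \<in> borel_measurable borel"
  shows "(\<lambda>x. \<integral>\<^sup>+y. f y \<partial>Q x) \<in> borel_measurable borel"
  using assms
proof (induction rule: borel_measurable_induct)
  case (cong f g)
  then have "f = g" by auto
  with cong show ?case by simp
next
  case (set A)
  then show ?case by simp
next
  case (mult u c)
  then have "(\<lambda>x. \<integral>\<^sup>+y. c * u y \<partial>Q x) = (\<lambda>x. c * \<integral>\<^sup>+y. u y \<partial>Q x)"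
    by (intro ext nn_integral_cmult) measurable
  with mult show ?case by simp
next
  case (add u v)
  then have "(\<lambda>x. \<integral>\<^sup>+y. v y + u y \<partial>Q x) = (\<lambda>x. (\<integral>\<^sup>+y. v y \<partial>Q x) + (\<integral>\<^sup>+y. u y \<partial>Q x))"
    by (intro ext nn_integral_add) (simp_all cong: measurable_cong_sets)
  with add show ?case by simp
next
  case (seq U)
  then have "(\<lambda>x. \<integral>\<^sup>+y. (SUP i. U i) y \<partial>Q x) = (\<lambda>x. SUP i. \<integral>\<^sup>+y. U i y \<partial>Q x)"
    unfolding SUP_apply
    by (intro ext nn_integral_monotone_convergence_SUP) measurable
  with seq show ?case by simp
qed

text \<open>The identity on sets extends to nonnegative functions through simple functions and
  monotone limits. It turns the fixed-point equation into a relation that can be iterated on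
  functions.\<close>

lemma nn_integral_kernel_eigenmeasure:
  assumes sets [simp, measurable_cong]: "sets \<mu> = sets borel"
    and eq: "\<And>A. A \<in> sets borel \<Longrightarrow> (\<integral>\<^sup>+x. emeasure (Q x) A \<partial>\<mu>) = c * emeasure \<mu> A"
    and f: "f \<in> borel_measurable borel"
  shows "(\<integral>\<^sup>+x. \<integral>\<^sup>+y. f y \<partial>Q x \<partial>\<mu>) = c * (\<integral>\<^sup>+x. f x \<partial>\<mu>)"
  using f
proof (induction rule: borel_measurable_induct)
  case (cong f g)
  then have "f = g" by auto
  with cong show ?case by simp
next
  case (set A)
  then show ?case by (simp add: eq)
next
  case (mult u d)
  note [measurable] = mult.hyps
  have "(\<integral>\<^sup>+x. \<integral>\<^sup>+y. d * u y \<partial>Q x \<partial>\<mu>) = d * (\<integral>\<^sup>+x. \<integral>\<^sup>+y. u y \<partial>Q x \<partial>\<mu>)"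
    by (simp add: nn_integral_cmult)
  with mult.IH show ?case by (simp add: nn_integral_cmult mult_ac)
next
  case (add u v)
  note [measurable] = add.hyps
  have "(\<integral>\<^sup>+x. \<integral>\<^sup>+y. v y + u y \<partial>Q x \<partial>\<mu>)
      = (\<integral>\<^sup>+x. \<integral>\<^sup>+y. v y \<partial>Q x \<partial>\<mu>) + (\<integral>\<^sup>+x. \<integral>\<^sup>+y. u y \<partial>Q x \<partial>\<mu>)"
    by (simp add: nn_integral_add)
  with add.IH show ?case by (simp add: nn_integral_add distrib_left)
next
  case (seq U)
  note [measurable] = seq.hyps(1)
  have "(\<integral>\<^sup>+x. \<integral>\<^sup>+y. (SUP i. U i) y \<partial>Q x \<partial>\<mu>) = (\<integral>\<^sup>+x. (SUP i. \<integral>\<^sup>+y. U i y \<partial>Q x) \<partial>\<mu>)"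
    unfolding SUP_apply using seq.hyps
    by (intro nn_integral_cong nn_integral_monotone_convergence_SUP) measurable
  also have "\<dots> = (SUP i. \<integral>\<^sup>+x. \<integral>\<^sup>+y. U i y \<partial>Q x \<partial>\<mu>)"
    using seq.hyps
    by (intro nn_integral_monotone_convergence_SUP)
      (auto simp: incseq_def le_fun_def intro!: nn_integral_mono)
  also have "\<dots> = (SUP i. c * \<integral>\<^sup>+x. U i x \<partial>\<mu>)" by (simp add: seq.IH)
  also have "\<dots> = c * (\<integral>\<^sup>+x. (SUP i. U i) x \<partial>\<mu>)"
    unfolding SUP_apply using seq.hyps
    by (subst nn_integral_monotone_convergence_SUP) (auto simp: SUP_mult_left_ennreal)
  finally show ?case .
qed

text \<open>\<open>measure_of\<close> returns the prescribed values only for a countably additive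
  set function. Here additivity follows by exchanging sum and integral, since the normalising mass
  does not depend on the set.\<close>

lemma FK_map_emeasure:
  assumes sets [simp, measurable_cong]: "sets \<mu> = sets borel" and A: "A \<in> sets borel"
  shows "emeasure (FK_map Q \<mu>) A
    = (\<integral>\<^sup>+x. emeasure (Q x) A \<partial>\<mu>) / (\<integral>\<^sup>+x. emeasure (Q x) UNIV \<partial>\<mu>)"
  unfolding FK_map_def
proof (rule emeasure_measure_of_sigma)
  show "sigma_algebra UNIV (sets (borel :: 'a measure))"
    using sets.sigma_algebra_axioms[of "borel :: 'a measure"] by simp
  show "countably_additive (sets borel)
     (\<lambda>A. (\<integral>\<^sup>+x. emeasure (Q x) A \<partial>\<mu>) / (\<integral>\<^sup>+x. emeasure (Q x) UNIV \<partial>\<mu>))"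
  proof (rule countably_additiveI)
    fix B :: "nat \<Rightarrow> 'a set"
    assume B: "range B \<subseteq> sets borel" "disjoint_family B"
    then have [measurable]: "B i \<in> sets borel" for i by auto
    have "(\<integral>\<^sup>+x. emeasure (Q x) (\<Union>i. B i) \<partial>\<mu>) = (\<integral>\<^sup>+x. (\<Sum>i. emeasure (Q x) (B i)) \<partial>\<mu>)"
      using B by (simp add: suminf_emeasure)
    also have "\<dots> = (\<Sum>i. \<integral>\<^sup>+x. emeasure (Q x) (B i) \<partial>\<mu>)"
      by (rule nn_integral_suminf) measurable
    finally show "(\<Sum>i. (\<integral>\<^sup>+x. emeasure (Q x) (B i) \<partial>\<mu>) / (\<integral>\<^sup>+x. emeasure (Q x) UNIV \<partial>\<mu>))
        = (\<integral>\<^sup>+x. emeasure (Q x) (\<Union>i. B i) \<partial>\<mu>) / (\<integral>\<^sup>+x. emeasure (Q x) UNIV \<partial>\<mu>)"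
      by simp
  qed
qed (use A in \<open>auto simp: positive_def\<close>)

text \<open>Multiplying the fixed-point equation by the normalising mass removes the quotient, once
  this mass is known to be neither zero nor infinite.\<close>

lemma FK_fixed_point_eigenmeasure:
  assumes \<mu>: "\<mu> \<in> prob_measures" "FK_map Q \<mu> = \<mu>"
    and fin: "(\<integral>\<^sup>+x. emeasure (Q x) UNIV \<partial>\<mu>) < \<infinity>"
    and A: "A \<in> sets borel"
  shows "(\<integral>\<^sup>+x. emeasure (Q x) A \<partial>\<mu>) = (\<integral>\<^sup>+x. emeasure (Q x) UNIV \<partial>\<mu>) * emeasure \<mu> A"
proof -
  let ?D = "\<integral>\<^sup>+x. emeasure (Q x) UNIV \<partial>\<mu>"
  have s: "sets \<mu> = sets borel" and p: "prob_space \<mu>" using \<mu> by (auto simp: prob_measures_def)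
  have eq: "emeasure \<mu> B = (\<integral>\<^sup>+x. emeasure (Q x) B \<partial>\<mu>) / ?D" if "B \<in> sets borel" for B
    using FK_map_emeasure[OF s that] \<mu>(2) by simp
  have "emeasure \<mu> UNIV = 1"
    using prob_space.emeasure_space_1[OF p] sets_eq_imp_space_eq[OF s] by simp
  \<comment> \<open>In \<open>ennreal\<close>, \<open>0 / 0 = 0\<close>, so a vanishing mass would
    contradict total mass one.\<close>
  then have "?D \<noteq> 0" using eq[of UNIV] by auto
  then show ?thesis using fin eq[OF A]
    by (simp add: ennreal_times_divide ennreal_mult_divide_eq mult.commute less_top)
qed

end

section \<open>Two facts from real analysis\<close>

text \<open>Points where the functions stay above \<open>e\<close> cluster at some point of
  \<open>K\<close>; by monotonicity and continuity every \<open>f i\<close> is at least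
  \<open>e\<close> there, against the pointwise limit.\<close>

lemma Dini_zero:
  fixes f :: "nat \<Rightarrow> 'a::metric_space \<Rightarrow> real"
  assumes K: "compact K" and cont: "\<And>j. continuous_on K (f j)"
    and dec: "\<And>i j x. x \<in> K \<Longrightarrow> i \<le> j \<Longrightarrow> f j x \<le> f i x"
    and lim: "\<And>x. x \<in> K \<Longrightarrow> (\<lambda>j. f j x) \<longlonglongrightarrow> 0"
    and e: "e > 0"
  shows "\<exists>j0. \<forall>j\<ge>j0. \<forall>x\<in>K. f j x < e"
proof (rule ccontr)
  assume "\<not> ?thesis"
  \<comment> \<open>The functions decrease, so failure at some late index gives failure at every
    earlier one.\<close>
  then have "\<forall>j. \<exists>x\<in>K. e \<le> f j x" by (meson dec not_less order_trans)
  then obtain y where y: "\<And>j. y j \<in> K" "\<And>j. e \<le> f j (y j)" by metis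
  obtain x s where x: "x \<in> K" and s: "strict_mono (s::nat \<Rightarrow> nat)" and l: "(y \<circ> s) \<longlonglongrightarrow> x"
    using K y(1) unfolding compact_def by metis
  have "e \<le> f i x" for i
  proof (rule LIMSEQ_le_const)
    show "(\<lambda>j. f i ((y \<circ> s) j)) \<longlonglongrightarrow> f i x"
      by (rule continuous_on_tendsto_compose[OF cont l x]) (simp add: y)
    \<comment> \<open>\<open>N = i\<close> works: \<open>s n\<close> is at least \<open>n\<close>,
      hence at least \<open>i\<close>, and \<open>f i\<close> dominates
      \<open>f (s n)\<close>.\<close>
    show "\<exists>N. \<forall>n\<ge>N. e \<le> f i ((y \<circ> s) n)"
      by (metis comp_def dec order_trans s seq_suble y)
  qed
  then have "e \<le> 0" using LIMSEQ_le_const[OF lim[OF x]] by blast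
  with e show False by simp
qed

lemma tendsto_root_geometric:
  fixes c r :: real
  assumes "c > 0" "r > 0"
  shows "(\<lambda>k. (c * r ^ k) powr (1 / real k)) \<longlonglongrightarrow> r"
proof -
  have "(\<lambda>k. c powr (1 / real k) * r) \<longlonglongrightarrow> c powr 0 * r"
    using assms by (intro tendsto_intros) (auto intro: lim_1_over_n)
  \<comment> \<open>Index \<open>0\<close> is excluded: there \<open>1 / real k\<close> is
    \<open>0\<close> and the two sides are \<open>r\<close> and \<open>1\<close>.\<close>
  moreover have "\<forall>\<^sub>F k in sequentially. c powr (1 / real k) * r = (c * r ^ k) powr (1 / real k)"
    using eventually_gt_at_top[of 0]
    by eventually_elim (use assms in \<open>simp add: powr_mult powr_powr flip: powr_realpow\<close>)
  ultimately show ?thesis using assms by (simp add: tendsto_cong)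
qed

text \<open>Multiplicative constants disappear under the \<open>k\<close>-th root, so bounds at all
  rates strictly above and strictly below \<open>\<rho>\<close> suffice, with constants depending on
  the rate.\<close>

lemma tendsto_root_of_geometric_bounds:
  fixes z :: "nat \<Rightarrow> real"
  assumes nn: "\<And>k. 0 \<le> z k" and \<rho>: "0 \<le> \<rho>"
    and up: "\<And>r. \<rho> < r \<Longrightarrow> \<exists>C. \<forall>\<^sub>F k in sequentially. z k \<le> C * r ^ k"
    and lo: "\<And>r. 0 < r \<Longrightarrow> r < \<rho> \<Longrightarrow> \<exists>c>0. \<forall>\<^sub>F k in sequentially. c * r ^ k \<le> z k"
  shows "(\<lambda>k. z k powr (1 / real k)) \<longlonglongrightarrow> \<rho>"
proof (rule order_tendstoI)
  fix a assume "a < \<rho>"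
  show "\<forall>\<^sub>F k in sequentially. a < z k powr (1 / real k)"
  \<comment> \<open>The lower bounds concern positive rates only; below zero, nonnegativity of
    \<open>powr\<close> is enough.\<close>
  proof (cases "a < 0")
    case True
    then show ?thesis by (intro always_eventually allI) (meson less_le_trans powr_ge_zero)
  next
    case False
    obtain r where r: "a < r" "r < \<rho>" using dense[OF \<open>a < \<rho>\<close>] by blast
    then obtain c where c: "c > 0" "\<forall>\<^sub>F k in sequentially. c * r ^ k \<le> z k"
      using lo[of r] False by auto
    have "\<forall>\<^sub>F k in sequentially. a < (c * r ^ k) powr (1 / real k)"
      using order_tendstoD(1)[OF tendsto_root_geometric[of c r]] c r False by auto
    with c(2) show ?thesis
    proof eventually_elim
      case (elim k)
      have "(c * r ^ k) powr (1 / real k) \<le> z k powr (1 / real k)"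
        using elim c r False by (intro powr_mono2) auto
      with elim show ?case by simp
    qed
  qed
next
  fix a assume "\<rho> < a"
  then obtain r where r: "\<rho> < r" "r < a" using dense by blast
  then obtain C where C: "\<forall>\<^sub>F k in sequentially. z k \<le> C * r ^ k" using up by blast
  \<comment> \<open>The constant \<open>C\<close> may fail to be positive, which the root limit
    requires.\<close>
  define c where "c = max C 1"
  have "\<forall>\<^sub>F k in sequentially. (c * r ^ k) powr (1 / real k) < a"
    using order_tendstoD(2)[OF tendsto_root_geometric[of c r]] r \<rho> by (auto simp: c_def)
  with C show "\<forall>\<^sub>F k in sequentially. z k powr (1 / real k) < a"
  proof eventually_elim
    case (elim k)
    have "z k \<le> c * r ^ k"
      using elim(1) r \<rho> by (smt (verit) c_def max.cobounded1 mult_right_mono zero_le_power)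
    then have "z k powr (1 / real k) \<le> (c * r ^ k) powr (1 / real k)"
      using nn by (intro powr_mono2) auto
    with elim show ?case by simp
  qed
qed

section \<open>The cone of nonnegative functions dominated by the weight\<close>

locale lyapunov_kernel = finite_kernel Q
  for Q :: "'a::polish_space \<Rightarrow> 'a measure" +
  fixes K :: "nat \<Rightarrow> 'a set" and W :: "'a \<Rightarrow> real" and \<gamma> b :: "nat \<Rightarrow> real"
  assumes exhaustion: "compact_exhaustion K"
    and lyapunov: "lyapunov_assm Q K W \<gamma> b"
begin

abbreviation P :: "('a \<Rightarrow> real) \<Rightarrow> 'a \<Rightarrow> real" where
  "P \<equiv> Qop Q"

text \<open>This is the positive cone of the weighted space. Its members are integrable against
  every \<open>Q x\<close>, so there the Bochner integral in \<open>Qop\<close> is additive and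
  monotone.\<close>

definition cone :: "('a \<Rightarrow> real) set" where
  "cone = {f \<in> borel_measurable borel. (\<forall>x. 0 \<le> f x) \<and> (\<exists>C. \<forall>x. f x \<le> C * W x)}"

lemma W_measurable [measurable]: "W \<in> borel_measurable borel"
  and W_ge_1: "1 \<le> W x"
  and \<gamma>_pos: "0 < \<gamma> n" and b_pos: "0 < b n"
  and \<gamma>_tendsto: "\<gamma> \<longlonglongrightarrow> 0"
  and nn_integral_W_le: "(\<integral>\<^sup>+y. ennreal (W y) \<partial>Q x) \<le> ennreal (\<gamma> n * W x + b n * indicator (K n) x)"
  using lyapunov by (auto simp: lyapunov_assm_def)

lemma W_pos: "0 < W x"
  using W_ge_1[of x] by linarith

lemma W_bdd_compact: "compact C \<Longrightarrow> bdd_above (W ` C)"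
  using lyapunov by (auto simp: lyapunov_assm_def)

lemma K_compact: "compact (K n)" and K_mono: "m \<le> n \<Longrightarrow> K m \<subseteq> K n"
  using exhaustion by (auto simp: compact_exhaustion_def incseq_def)

lemma K_measurable [measurable]: "K n \<in> sets borel"
  by (simp add: K_compact borel_compact)

lemma K_cover: "\<exists>n. x \<in> K n"
proof -
  have "\<exists>n. {x} \<subseteq> K n" using exhaustion compact_sing[of x] unfolding compact_exhaustion_def by metis
  then show ?thesis by simp
qed

lemma \<gamma>_eventually_small: "0 < e \<Longrightarrow> \<exists>N. \<forall>n\<ge>N. \<gamma> n < e"
  using order_tendstoD(2)[OF \<gamma>_tendsto] by (simp add: eventually_sequentially)

section \<open>Closure properties of the cone and integrability\<close>

lemma coneD: "f \<in> cone \<Longrightarrow> f \<in> borel_measurable borel" "f \<in> cone \<Longrightarrow> 0 \<le> f x"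
  by (auto simp: cone_def)

lemma cone_bound:
  assumes "f \<in> cone"
  obtains C where "C > 0" "\<And>x. f x \<le> C * W x"
proof -
  obtain C where C: "\<And>x. f x \<le> C * W x" using assms by (auto simp: cone_def)
  have "f x \<le> max C 1 * W x" for x
    using C[of x] W_pos[of x] by (smt (verit) max.cobounded1 mult_right_mono)
  then show ?thesis using that[of "max C 1"] by auto
qed

lemma cone_mono:
  assumes "g \<in> cone" "f \<in> borel_measurable borel" "\<And>x. 0 \<le> f x" "\<And>x. f x \<le> g x"
  shows "f \<in> cone"
  using assms by (auto simp: cone_def) (meson order_trans)

lemma cone_W: "W \<in> cone"
  unfolding cone_def using W_pos by (auto simp: less_imp_le intro!: exI[of _ 1])

lemma cone_one: "(\<lambda>_. 1) \<in> cone"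
  by (rule cone_mono[OF cone_W]) (auto simp: W_ge_1)

lemma cone_add:
  assumes "f \<in> cone" "g \<in> cone"
  shows "(\<lambda>x. f x + g x) \<in> cone"
proof -
  obtain C D where "\<And>x. f x \<le> C * W x" "\<And>x. g x \<le> D * W x"
    using assms cone_bound by metis
  then have "f x + g x \<le> (C + D) * W x" for x by (simp add: distrib_right add_mono)
  with assms show ?thesis by (auto simp: cone_def)
qed

lemma cone_cmult:
  assumes "f \<in> cone" "0 \<le> c"
  shows "(\<lambda>x. c * f x) \<in> cone"
proof -
  obtain C where "\<And>x. f x \<le> C * W x" using assms cone_bound by metis
  then have "c * f x \<le> (c * C) * W x" for x using assms by (simp add: mult.assoc mult_left_mono)
  with assms show ?thesis by (auto simp: cone_def)
qed

lemma cone_integrable: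
  assumes [measurable_cong]: "sets M = sets borel" and fin: "(\<integral>\<^sup>+x. ennreal (W x) \<partial>M) < \<infinity>"
    and f: "f \<in> cone"
  shows "integrable M f"
proof -
  obtain C where C: "\<And>x. f x \<le> C * W x" using f cone_bound by metis
  have "integrable M W"
    by (rule integrableI_nonneg) (use fin W_pos in \<open>auto simp: less_imp_le\<close>)
  then have "integrable M (\<lambda>x. C * W x)" by simp
  then show ?thesis
    using coneD[OF f] C
    by (elim Bochner_Integration.integrable_bound) (auto simp: order_trans[OF _ abs_ge_self])
qed

lemma integrable_kernel: "f \<in> cone \<Longrightarrow> integrable (Q x) f"
  by (rule cone_integrable) (use nn_integral_W_le[of x 0] in \<open>auto simp: order_le_less_trans\<close>)

lemma ennreal_P: "f \<in> cone \<Longrightarrow> ennreal (P f x) = (\<integral>\<^sup>+y. ennreal (f y) \<partial>Q x)"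
  by (simp add: Qop_def nn_integral_eq_integral[OF integrable_kernel] coneD)

lemma P_W_le: "P W x \<le> \<gamma> n * W x + b n * indicator (K n) x"
proof -
  have "ennreal (P W x) \<le> ennreal (\<gamma> n * W x + b n * indicator (K n) x)"
    using nn_integral_W_le by (simp add: ennreal_P cone_W)
  moreover have "0 \<le> \<gamma> n * W x + b n * indicator (K n) x"
    using \<gamma>_pos[of n] b_pos[of n] W_pos[of x] by (simp add: less_imp_le)
  ultimately show ?thesis by simp
qed

lemma P_W_le_W: "P W x \<le> (\<gamma> n + b n) * W x"
proof -
  have "b n * indicator (K n) x \<le> b n * W x"
    using b_pos[of n] W_ge_1[of x] by (intro mult_left_mono) (auto split: split_indicator)
  then show ?thesis using P_W_le[of x n] by (simp add: distrib_right)
qed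

section \<open>Positivity of the operator and of its iterates\<close>

lemma P_nonneg: "f \<in> cone \<Longrightarrow> 0 \<le> P f x"
  by (simp add: Qop_def coneD)

lemma P_mono: "f \<in> cone \<Longrightarrow> g \<in> cone \<Longrightarrow> (\<And>x. f x \<le> g x) \<Longrightarrow> P f x \<le> P g x"
  unfolding Qop_def by (intro integral_mono integrable_kernel)

lemma P_add: "f \<in> cone \<Longrightarrow> g \<in> cone \<Longrightarrow> P (\<lambda>x. f x + g x) = (\<lambda>x. P f x + P g x)"
  unfolding Qop_def by (intro ext Bochner_Integration.integral_add integrable_kernel)

lemma P_cmult: "P (\<lambda>x. c * f x) = (\<lambda>x. c * P f x)"
  unfolding Qop_def by simp

lemma P_cone:
  assumes f: "f \<in> cone"
  shows "P f \<in> cone"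
proof -
  note [measurable] = coneD(1)[OF f]
  obtain C where C: "C > 0" "\<And>x. f x \<le> C * W x" using f cone_bound by metis
  \<comment> \<open>Measurability in \<open>x\<close> was established for nonnegative integrals, so
    the Bochner integral is rewritten as one.\<close>
  have eq: "P f = (\<lambda>x. enn2real (\<integral>\<^sup>+y. ennreal (f y) \<partial>Q x))"
    by (simp add: P_nonneg f flip: ennreal_P)
  have "P f \<in> borel_measurable borel" unfolding eq by measurable
  moreover have "P f x \<le> (C * (\<gamma> 0 + b 0)) * W x" for x
  proof -
    have "P f x \<le> P (\<lambda>x. C * W x) x"
      using C by (intro P_mono f cone_cmult cone_W) auto
    also have "\<dots> \<le> C * ((\<gamma> 0 + b 0) * W x)"
      using C P_W_le_W by (simp add: P_cmult)
    finally show ?thesis by (simp add: mult.assoc)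
  qed
  ultimately show ?thesis using P_nonneg[OF f] by (auto simp: cone_def)
qed

lemma Pk_cone: "f \<in> cone \<Longrightarrow> (P ^^ k) f \<in> cone"
  by (induction k) (auto intro: P_cone)

lemma Pk_nonneg: "f \<in> cone \<Longrightarrow> 0 \<le> (P ^^ k) f x"
  using coneD(2) Pk_cone by blast

text \<open>A pointwise inequality survives a positive linear operator. Two terms on the right
  accommodate drift bounds, in which a multiple of \<open>W\<close> is accompanied by a second
  function.\<close>

lemma Pk_lincomb_le:
  assumes "f \<in> cone" "g \<in> cone" "h \<in> cone" "0 \<le> c" "0 \<le> d"
    and le: "\<And>x. f x \<le> c * g x + d * h x"
  shows "(P ^^ k) f x \<le> c * (P ^^ k) g x + d * (P ^^ k) h x"
proof (induction k arbitrary: x)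
  case 0
  then show ?case using le by simp
next
  case (Suc k)
  have "(P ^^ Suc k) f x \<le> P (\<lambda>x. c * (P ^^ k) g x + d * (P ^^ k) h x) x"
    using assms Suc.IH by (auto intro!: P_mono Pk_cone cone_add cone_cmult)
  also have "\<dots> = c * (P ^^ Suc k) g x + d * (P ^^ Suc k) h x"
    using assms by (simp add: P_add P_cmult cone_cmult Pk_cone)
  finally show ?case .
qed

lemma Pk_mono:
  assumes "f \<in> cone" "g \<in> cone" "0 \<le> c" "\<And>x. f x \<le> c * g x"
  shows "(P ^^ k) f x \<le> c * (P ^^ k) g x"
  using Pk_lincomb_le[of f g g c 0 k x] assms by simp

lemma abs_Pk_le:
  assumes "\<And>x. \<bar>\<phi> x\<bar> \<le> W x"
  shows "\<bar>(P ^^ k) \<phi> x\<bar> \<le> (P ^^ k) W x"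
proof (induction k arbitrary: x)
  case 0
  then show ?case using assms by simp
next
  case (Suc k)
  show ?case
  proof (cases "integrable (Q x) ((P ^^ k) \<phi>)")
    case True
    have "\<bar>P ((P ^^ k) \<phi>) x\<bar> \<le> (\<integral>y. \<bar>(P ^^ k) \<phi> y\<bar> \<partial>Q x)"
      unfolding Qop_def by (rule integral_abs_bound)
    also have "\<dots> \<le> P ((P ^^ k) W) x"
      unfolding Qop_def[of Q "(Qop Q ^^ k) W"]
      by (intro integral_mono integrable_kernel Pk_cone cone_W integrable_abs True Suc.IH)
    finally show ?thesis by simp
  next
    case False
    \<comment> \<open>A Bochner integral that does not exist has the default value zero, so the
      bound holds in this case too.\<close>
    then have "P ((P ^^ k) \<phi>) x = 0" unfolding Qop_def by (rule not_integrable_integral_eq)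
    then show ?thesis using Pk_nonneg[OF cone_W, of "Suc k" x] by simp
  qed
qed

section \<open>The weighted norm and the operator norms of the iterates\<close>

lemma bdd_above_cone:
  assumes "f \<in> cone"
  shows "bdd_above (range (\<lambda>x. f x / W x))"
proof -
  obtain C where "\<And>x. f x \<le> C * W x" using assms cone_bound by metis
  then show ?thesis using W_pos by (intro bdd_aboveI[of _ C]) (auto simp: divide_le_eq)
qed

lemma wnorm_cone: "f \<in> cone \<Longrightarrow> wnorm W f = (SUP x. f x / W x)"
  by (simp add: wnorm_def coneD)

lemma le_wnorm:
  assumes "f \<in> cone"
  shows "f x \<le> wnorm W f * W x"
proof -
  have "f x / W x \<le> wnorm W f"
    unfolding wnorm_cone[OF assms] by (rule cSUP_upper[OF _ bdd_above_cone[OF assms]]) simp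
  then show ?thesis using W_pos[of x] by (simp add: divide_le_eq)
qed

lemma wnorm_le:
  assumes "\<And>x. \<bar>f x\<bar> \<le> C * W x"
  shows "wnorm W f \<le> C"
  unfolding wnorm_def by (rule cSUP_least) (use assms W_pos in \<open>auto simp: divide_le_eq\<close>)

lemma wnorm_nonneg: "f \<in> cone \<Longrightarrow> 0 \<le> wnorm W f"
  using le_wnorm[of f undefined] coneD(2)[of f undefined] W_pos[of undefined]
  by (meson order_trans zero_le_mult_iff not_le)

text \<open>By positivity \<open>W\<close> is extremal in the unit ball. The supremum is thus a
  maximum, and norm estimates become pointwise estimates on \<open>(P ^^ k) W\<close>.\<close>

lemma opnormW_eq: "opnormW Q W k = wnorm W ((P ^^ k) W)"
  unfolding opnormW_def
proof (rule cSup_eq_maximum)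
  have "bdd_above (range (\<lambda>x. \<bar>W x\<bar> / W x))"
    using bdd_above_cone[OF cone_W] W_pos by (simp add: abs_of_pos)
  moreover have "wnorm W W \<le> 1"
    by (rule wnorm_le) (simp add: W_pos abs_of_pos)
  ultimately show "wnorm W ((P ^^ k) W) \<in>
      {wnorm W ((P ^^ k) \<phi>) | \<phi>. \<phi> \<in> LinfW W \<and> wnorm W \<phi> \<le> 1}"
    by (auto simp: LinfW_def)
next
  fix y assume "y \<in> {wnorm W ((P ^^ k) \<phi>) | \<phi>. \<phi> \<in> LinfW W \<and> wnorm W \<phi> \<le> 1}"
  then obtain \<phi> where y: "y = wnorm W ((P ^^ k) \<phi>)"
    and bdd: "bdd_above (range (\<lambda>x. \<bar>\<phi> x\<bar> / W x))" and le: "wnorm W \<phi> \<le> 1"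
    by (auto simp: LinfW_def)
  have "\<bar>\<phi> x\<bar> \<le> W x" for x
  proof -
    have "\<bar>\<phi> x\<bar> / W x \<le> 1"
      using cSUP_upper[OF _ bdd, of x] le unfolding wnorm_def by simp
    then show ?thesis using W_pos[of x] by (simp add: divide_le_eq)
  qed
  then have "\<bar>(P ^^ k) \<phi> x\<bar> \<le> wnorm W ((P ^^ k) W) * W x" for x
    using abs_Pk_le le_wnorm[OF Pk_cone[OF cone_W]] by (meson order_trans)
  then show "y \<le> wnorm W ((P ^^ k) W)" unfolding y by (rule wnorm_le)
qed

end

section \<open>Subeigenfunctions\<close>

locale regular_lyapunov_kernel = lyapunov_kernel +
  assumes regularity: "regularity_assm Q K"
begin

text \<open>The subeigenfunction is the pointwise limes superior of the approximate ones. It does not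
  vanish: otherwise, by Dini's theorem (this is where the local regularity enters),
  the functions \<^term>\<open>P (g N)\<close> would tend to zero uniformly on the compact sets outside of which
  the Lyapunov condition makes them small.\<close>

lemma subeigenfunction_of_approximate:
  assumes r: "0 < r" and g: "\<And>N. g N \<in> cone" "\<And>N x. g N x \<le> W x"
    and \<epsilon>: "decseq \<epsilon>" "\<epsilon> \<longlonglongrightarrow> 0"
    and approx: "\<And>N x. r * g N x \<le> P (g N) x + \<epsilon> N * W x"
    and large: "\<And>N. \<exists>x. W x / 2 \<le> g N x"
  shows "\<exists>h\<in>cone. (\<exists>x. 0 < h x) \<and> (\<forall>x. r * h x \<le> P h x)"
proof -
  note [measurable] = coneD(1)[OF g(1)]
  \<comment> \<open>The \<open>g N\<close> need not be monotone in \<open>N\<close>; their tail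
    suprema decrease to the limes superior \<open>h\<close>, which is what Dini's theorem
    needs.\<close>
  define u where "u j x = (SUP i\<in>{j..}. g i x)" for j x
  define h where "h x = (INF j. u j x)" for x
  have bdd: "bdd_above ((\<lambda>i. g i x) ` {j..})" for j x
    by (rule bdd_aboveI[of _ "W x"]) (use g(2) in auto)
  have gu: "g i x \<le> u j x" if "j \<le> i" for i j x
    unfolding u_def by (rule cSUP_upper[OF _ bdd]) (use that in simp)
  have u_le: "u j x \<le> W x" for j x
    unfolding u_def by (rule cSUP_least) (use g(2) in auto)
  have u_nonneg: "0 \<le> u j x" for j x
    using gu[of j j x] coneD(2)[OF g(1)] order_trans by blast
  have u_meas [measurable]: "u j \<in> borel_measurable borel" for j
    unfolding u_def[abs_def] by (rule borel_measurable_cSUP) (use bdd in auto)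
  have u_cone: "u j \<in> cone" for j
    by (rule cone_mono[OF cone_W]) (auto simp: u_nonneg u_le)
  have u_dec: "u j x \<le> u i x" if "i \<le> j" for i j x
    unfolding u_def[of j] by (rule cSUP_least) (use that gu in auto)
  have bdd': "bdd_below (range (\<lambda>j. u j x))" for x
    by (rule bdd_belowI[of _ 0]) (use u_nonneg in auto)
  have u_lim: "(\<lambda>j. u j x) \<longlonglongrightarrow> h x" for x
    unfolding h_def by (rule LIMSEQ_decseq_INF[OF bdd']) (auto simp: decseq_def u_dec)
  have h_meas [measurable]: "h \<in> borel_measurable borel"
    by (rule borel_measurable_LIMSEQ_real[OF u_lim]) auto
  have h_nonneg: "0 \<le> h x" for x
    by (rule LIMSEQ_le_const[OF u_lim]) (use u_nonneg in auto)
  have h_le: "h x \<le> W x" for x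
    by (rule LIMSEQ_le_const2[OF u_lim]) (use u_le in auto)
  have h_cone: "h \<in> cone"
    by (rule cone_mono[OF cone_W]) (auto simp: h_nonneg h_le)
  \<comment> \<open>For \<open>i\<close> beyond \<open>j\<close>, \<open>P (g i)\<close> is at most
    \<open>P (u j)\<close> and \<open>\<epsilon> i\<close> at most \<open>\<epsilon> j\<close>. The
    resulting bound on \<open>g i x\<close> does not depend on \<open>i\<close>, so it passes to the
    supremum.\<close>
  have u_approx: "r * u j x \<le> P (u j) x + \<epsilon> j * W x" for j x
  proof -
    have "g i x \<le> (P (u j) x + \<epsilon> j * W x) / r" if "j \<le> i" for i
    proof -
      have "P (g i) x \<le> P (u j) x"
        by (intro P_mono g(1) u_cone gu that)
      moreover have "\<epsilon> i * W x \<le> \<epsilon> j * W x"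
        using \<epsilon>(1) that W_pos[of x] by (auto simp: decseq_def intro!: mult_right_mono)
      ultimately show ?thesis using approx[of i x] r by (simp add: field_simps)
    qed
    then have "u j x \<le> (P (u j) x + \<epsilon> j * W x) / r"
      unfolding u_def[of j x] by (intro cSUP_least) auto
    then show ?thesis using r by (simp add: field_simps)
  qed
  have "r * h x \<le> P h x" for x
  proof (rule LIMSEQ_le)
    show "(\<lambda>j. r * u j x) \<longlonglongrightarrow> r * h x" by (intro tendsto_intros u_lim)
    have "(\<lambda>j. P (u j) x) \<longlonglongrightarrow> P h x"
      unfolding Qop_def
      by (rule integral_dominated_convergence[where w = W])
        (auto simp: u_lim u_le u_nonneg integrable_kernel cone_W)
    then have "(\<lambda>j. P (u j) x + \<epsilon> j * W x) \<longlonglongrightarrow> P h x + 0 * W x"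
      by (intro tendsto_intros \<epsilon>)
    then show "(\<lambda>j. P (u j) x + \<epsilon> j * W x) \<longlonglongrightarrow> P h x" by simp
    show "\<exists>N. \<forall>n\<ge>N. r * u n x \<le> P (u n) x + \<epsilon> n * W x" using u_approx by blast
  qed
  moreover have "\<exists>x. 0 < h x"
  proof (rule ccontr)
    assume "\<not> ?thesis"
    then have h0: "h x = 0" for x using h_nonneg[of x] by (simp add: not_less order_antisym)
    \<comment> \<open>\<open>P W\<close> is at most \<open>r * D * W\<close>. The choice of
      \<open>e\<close> makes the errors at the final point total at most \<open>r / 4 * W x\<close>
      (shares \<open>r / 16\<close>, \<open>2 * r / 16\<close>, \<open>r / 16\<close>), below the
      \<open>r / 2 * W x\<close> guaranteed by \<open>large\<close>.\<close>
    define D where "D = (\<gamma> 0 + b 0) / r"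
    have D: "D > 0" using \<gamma>_pos[of 0] b_pos[of 0] r by (simp add: D_def)
    define e where "e = min (r / 16) (r / (16 * D))"
    have e: "e > 0" "e \<le> r / 16" "e * D \<le> r / 16"
      using r D by (auto simp: e_def min_def field_simps)
    obtain m where m: "\<gamma> m < e" using \<gamma>_eventually_small[OF e(1)] by blast
    obtain j1 where j1: "\<And>j. j \<ge> j1 \<Longrightarrow> \<epsilon> j < e"
      using order_tendstoD(2)[OF \<epsilon>(2) e(1)] by (auto simp: eventually_sequentially)
    \<comment> \<open>Truncation to \<open>K m\<close> gives functions to which local regularity
      applies, so \<open>P (v j)\<close> is continuous on \<open>K m\<close>.\<close>
    define v where "v j = (\<lambda>x. u j x * indicator (K m) x)" for j
    have v_cone: "v j \<in> cone" for j
      unfolding v_def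
      by (rule cone_mono[OF cone_W])
        (auto simp: u_nonneg u_le less_imp_le[OF W_pos] split: split_indicator)
    have "\<exists>j0. \<forall>j\<ge>j0. \<forall>x\<in>K m. P (v j) x < r / 16"
    proof (rule Dini_zero)
      show "compact (K m)" by (rule K_compact)
      show "continuous_on (K m) (P (v j))" for j
      proof -
        have "bdd_above ((\<lambda>x. \<bar>u j x\<bar>) ` K m)"
        proof -
          obtain B where "\<And>x. x \<in> K m \<Longrightarrow> W x \<le> B"
            using W_bdd_compact[OF K_compact[of m]] by (auto simp: bdd_above_def)
          then show ?thesis
            by (intro bdd_aboveI[of _ B]) (auto simp: u_nonneg intro: order_trans[OF u_le])
        qed
        then show ?thesis using regularity unfolding regularity_assm_def v_def by auto
      qed
      show "P (v j) x \<le> P (v i) x" if "i \<le> j" for i j x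
        by (intro P_mono v_cone) (use u_dec[OF that] in \<open>auto simp: v_def split: split_indicator\<close>)
      show "(\<lambda>j. P (v j) x) \<longlonglongrightarrow> 0" for x
      proof -
        have "(\<lambda>j. P (v j) x) \<longlonglongrightarrow> P (\<lambda>_. 0) x"
          unfolding Qop_def
        proof (rule integral_dominated_convergence[where w = W])
          show "AE y in Q x. (\<lambda>j. v j y) \<longlonglongrightarrow> 0"
            unfolding v_def using tendsto_mult_right[OF u_lim] by (simp add: h0)
          show "AE y in Q x. norm (v j y) \<le> W y" for j
            by (auto simp: v_def u_nonneg u_le less_imp_le[OF W_pos] split: split_indicator)
        qed (auto simp: v_def integrable_kernel cone_W)
        then show ?thesis by (simp add: Qop_def)
      qed
    qed (use r in simp)
    then obtain j0 where j0: "\<And>j x. j \<ge> j0 \<Longrightarrow> x \<in> K m \<Longrightarrow> P (v j) x < r / 16" by blast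
    define j where "j = max j0 j1"
    have \<epsilon>j: "\<epsilon> j < e" using j1 by (simp add: j_def)
    have PuW: "r * u j x \<le> (\<gamma> m + \<epsilon> j) * W x + b m * indicator (K m) x" for x
      using u_approx[of j x] P_mono[OF u_cone cone_W u_le, of j x] P_W_le[of x m]
      by (simp add: distrib_right)
    obtain x where x: "W x / 2 \<le> u j x" using large[of j] gu[of j j] order_trans by blast
    have x': "r / 2 * W x \<le> r * u j x"
      using mult_left_mono[OF x, of r] r by simp
    have small: "(\<gamma> m + \<epsilon> j) * W y \<le> (2 * e) * W y" for y
      using m \<epsilon>j W_pos[of y] by (intro mult_right_mono) auto
    have eW: "e * W x \<le> r / 16 * W x" using e W_pos[of x] by (intro mult_right_mono) auto
    have rW: "0 < r * W x" "r \<le> r * W x" using r W_pos[of x] W_ge_1[of x] by auto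
    \<comment> \<open>Off \<open>K m\<close> the Lyapunov bound would give
      \<open>r / 2 * W x\<close> at most \<open>2 * e * W x\<close>, hence at most
      \<open>r / 8 * W x\<close>.\<close>
    have "x \<in> K m"
    proof (rule ccontr)
      assume "x \<notin> K m"
      then have "r / 2 * W x \<le> 2 * (e * W x)" using PuW[of x] small[of x] x' by simp
      then show False using eW rW by simp
    qed
    \<comment> \<open>Off \<open>K m\<close> the function \<open>u j\<close> is itself a small
      multiple of \<open>W\<close>, so truncation costs only that multiple.\<close>
    have split: "u j y \<le> v j y + (2 * e / r) * W y" for y
    proof (cases "y \<in> K m")
      case True
      then show ?thesis using e r W_pos[of y] by (simp add: v_def)
    next
      case False
      then have "r * u j y \<le> 2 * e * W y" using PuW[of y] small[of y] by simp
      then show ?thesis using False r by (simp add: v_def field_simps)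
    qed
    have "P (u j) x \<le> P (\<lambda>y. v j y + (2 * e / r) * W y) x"
      using e r by (intro P_mono u_cone cone_add cone_cmult v_cone cone_W split) auto
    also have "\<dots> = P (v j) x + (2 * e / r) * P W x"
      using e r by (subst P_add) (auto simp only: P_cmult intro!: cone_cmult v_cone cone_W, auto)
    also have "(2 * e / r) * P W x \<le> (2 * e / r) * ((\<gamma> 0 + b 0) * W x)"
      using e r by (intro mult_left_mono P_W_le_W) auto
    also have "\<dots> = 2 * ((e * D) * W x)" by (simp add: D_def)
    also have "\<dots> \<le> 2 * (r / 16 * W x)"
      using e W_pos[of x] by (intro mult_left_mono mult_right_mono) auto
    finally have "P (u j) x \<le> P (v j) x + 2 * (r / 16 * W x)" by simp
    moreover have "P (v j) x < r / 16" using j0[of j x] \<open>x \<in> K m\<close> by (simp add: j_def)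
    moreover have "\<epsilon> j * W x \<le> e * W x" using \<epsilon>j W_pos[of x] by (intro mult_right_mono) auto
    ultimately show False using u_approx[of j x] x' eW rW by simp
  qed
  ultimately show ?thesis using h_cone by blast
qed

text \<open>The partial sums \<open>H N\<close>, divided by their weighted norms \<open>c N\<close>,
  are approximate subeigenfunctions: the sum telescopes and leaves a defect of at most
  \<open>r / c N * W\<close>. Unboundedness of the rescaled iterates makes \<open>c N\<close>
  diverge.\<close>

lemma subeigenfunction_exists:
  assumes r: "0 < r" and unbounded: "\<not> (\<exists>C. \<forall>k x. (P ^^ k) W x \<le> C * r ^ k * W x)"
  shows "\<exists>h\<in>cone. (\<exists>x. 0 < h x) \<and> (\<forall>x. r * h x \<le> P h x)"
proof -
  define H where "H N = (\<lambda>x. \<Sum>k\<le>N. (1 / r ^ k) * (P ^^ k) W x)" for N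
  have H_Suc: "H (Suc N) = (\<lambda>x. H N x + (1 / r ^ Suc N) * (P ^^ Suc N) W x)" for N
    by (simp add: H_def)
  have H0: "H 0 = W" by (simp add: H_def)
  have term_cone: "(\<lambda>x. (1 / r ^ k) * (P ^^ k) W x) \<in> cone" for k
    using r by (intro cone_cmult Pk_cone cone_W) auto
  have H_cone: "H N \<in> cone" for N
  proof (induction N)
    case (Suc N)
    then show ?case unfolding H_Suc using term_cone by (rule cone_add)
  qed (simp add: H0 cone_W)
  \<comment> \<open>Applying \<open>P\<close> shifts the sum by one index, which loses its first
    term \<open>W\<close> and produces the factor \<open>r\<close>.\<close>
  have PH: "P (H N) x = r * (H (Suc N) x - W x)" for N x
  proof (induction N)
    case 0
    then show ?case using r by (simp add: H_def)
  next
    case (Suc N)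
    have "P (H (Suc N)) x = P (H N) x + (1 / r ^ Suc N) * (P ^^ Suc (Suc N)) W x"
      unfolding H_Suc P_add[OF H_cone term_cone] P_cmult by simp
    also have "\<dots> = r * (H (Suc (Suc N)) x - W x)"
      unfolding Suc H_Suc[of "Suc N"] using r by (simp add: field_simps)
    finally show ?case .
  qed
  have H_mono1: "H N x \<le> H (Suc N) x" for N x
    unfolding H_Suc using coneD(2)[OF term_cone, of "Suc N" x] by simp
  then have H_mono: "H M x \<le> H N x" if "M \<le> N" for M N x
    using lift_Suc_mono_le[of "\<lambda>n. H n x"] that by blast
  define c where "c N = wnorm W (H N)" for N
  have Hc: "H N x \<le> c N * W x" for N x unfolding c_def by (rule le_wnorm[OF H_cone])
  have c_mono: "c M \<le> c N" if "M \<le> N" for M N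
    unfolding c_def[of M]
    using H_mono[OF that] Hc[of N] coneD(2)[OF H_cone]
    by (intro wnorm_le) (auto intro: order_trans)
  have c1: "1 \<le> c N" for N
    using Hc[of 0 undefined] W_pos[of undefined] c_mono[of 0 N] by (simp add: H0)
  \<comment> \<open>Each rescaled iterate is a single term of a partial sum, so bounded
    \<open>c\<close> would bound all iterates geometrically.\<close>
  have c_unb: "\<exists>N. C < c N" for C
  proof (rule ccontr)
    assume "\<not> ?thesis"
    then have C: "c N \<le> C" for N by (simp add: not_less)
    have "(P ^^ k) W x \<le> C * r ^ k * W x" for k x
    proof -
      have "(1 / r ^ k) * (P ^^ k) W x \<le> H k x"
        unfolding H_def using coneD(2)[OF term_cone]
        by (intro member_le_sum[of k "{..k}" "\<lambda>k. (1 / r ^ k) * (P ^^ k) W x"]) auto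
      also have "\<dots> \<le> C * W x"
        using Hc[of k x] C[of k] W_pos[of x] by (meson less_imp_le mult_right_mono order_trans)
      finally show ?thesis using r by (simp add: field_simps)
    qed
    with unbounded show False by blast
  qed
  show ?thesis
  proof (rule subeigenfunction_of_approximate)
    show "(\<lambda>x. (1 / c N) * H N x) \<in> cone" for N
      using c1[of N] by (intro cone_cmult H_cone) auto
    show "(1 / c N) * H N x \<le> W x" for N x
      using Hc[of N x] c1[of N] by (simp add: field_simps)
    show "decseq (\<lambda>N. r / c N)"
      unfolding decseq_def using r c1 c_mono
      by (auto intro!: divide_left_mono mult_pos_pos intro: less_le_trans[OF zero_less_one])
    have "filterlim c at_top sequentially"
      unfolding filterlim_at_top eventually_sequentially
      by (meson c_mono c_unb less_imp_le order_trans)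
    then show "(\<lambda>N. r / c N) \<longlonglongrightarrow> 0"
      by (intro tendsto_divide_0[OF tendsto_const] filterlim_at_top_imp_at_infinity)
    show "r * ((1 / c N) * H N x) \<le> P (\<lambda>x. (1 / c N) * H N x) x + r / c N * W x" for N x
    proof -
      have "r * H N x \<le> P (H N) x + r * W x"
        unfolding PH using H_mono1[of N x] r by (simp add: algebra_simps)
      then have "(1 / c N) * (r * H N x) \<le> (1 / c N) * (P (H N) x + r * W x)"
        using c1[of N] by (intro mult_left_mono) auto
      then show ?thesis unfolding P_cmult by (simp add: algebra_simps)
    qed
    \<comment> \<open>\<open>c N\<close> is the least admissible constant for \<open>H N\<close>, so
      \<open>c N / 2\<close> must fail at some point.\<close>
    show "\<exists>x. W x / 2 \<le> (1 / c N) * H N x" for N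
    proof (rule ccontr)
      assume "\<not> ?thesis"
      then have "\<bar>H N x\<bar> \<le> (c N / 2) * W x" for x
        using c1[of N] coneD(2)[OF H_cone, of N x]
        by (auto simp: not_le field_simps dest!: spec[of _ x])
      then have "wnorm W (H N) \<le> c N / 2" by (rule wnorm_le)
      with c1[of N] show False by (simp add: c_def)
    qed
  qed (use r in simp)
qed

end

section \<open>Growth of the iterates\<close>

locale feynman_kac_kernel = regular_lyapunov_kernel Q K W \<gamma> b
  for Q :: "'a::polish_space \<Rightarrow> 'a measure" and K W \<gamma> b +
  fixes \<eta> :: "nat \<Rightarrow> 'a measure" and \<alpha> :: "nat \<Rightarrow> real"
  assumes minorization: "minorization_assm Q K W \<eta> \<alpha>"
begin

text \<open>If \<open>\<eta> n\<close> annihilated \<open>h\<close> for all \<open>n\<close> from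
  \<open>n0\<close> on, irreducibility would force \<open>P h = 0\<close>. So some such
  \<open>\<eta> n\<close> charges \<open>h\<close>, and minorization gives the lower bound on
  \<open>K n\<close>.\<close>

lemma P_bounded_below_on_compact:
  assumes h: "h \<in> cone" and pos: "0 < P h x0"
  shows "\<exists>n\<ge>n0. \<exists>c>0. \<forall>x\<in>K n. c \<le> P h x"
proof -
  note [measurable] = coneD(1)[OF h]
  have "h \<in> LinfW W" using bdd_above_cone[OF h] coneD[OF h] by (simp add: LinfW_def)
  moreover have "(\<integral>\<^sup>+y. ennreal (h y) \<partial>Q x0) \<noteq> 0"
    using pos by (simp flip: ennreal_P[OF h])
  ultimately obtain n where n: "n \<ge> n0" and nz: "(\<integral>\<^sup>+y. ennreal (h y) \<partial>\<eta> n) \<noteq> 0"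
    using minorization coneD(2)[OF h] unfolding minorization_assm_def by metis
  have sets_\<eta> [simp, measurable_cong]: "sets (\<eta> n) = sets borel" and \<alpha>: "\<alpha> n > 0"
    and mino: "\<And>x A. x \<in> K n \<Longrightarrow> A \<in> sets borel \<Longrightarrow>
      ennreal (\<alpha> n) * emeasure (\<eta> n) A \<le> emeasure (Q x) A"
    using minorization unfolding minorization_assm_def prob_measures_def by auto
  define e where "e = ennreal (\<alpha> n) * (\<integral>\<^sup>+y. ennreal (h y) \<partial>\<eta> n)"
  have "e \<noteq> 0" using nz \<alpha> by (simp add: e_def)
  have e_le: "e \<le> ennreal (P h x)" if "x \<in> K n" for x
  proof -
    have "e = (\<integral>\<^sup>+y. ennreal (h y) \<partial>scale_measure (ennreal (\<alpha> n)) (\<eta> n))"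
      unfolding e_def by (rule nn_integral_scale_measure[symmetric]) measurable
    also have "\<dots> \<le> (\<integral>\<^sup>+y. ennreal (h y) \<partial>Q x)"
    proof (rule nn_integral_mono_measure)
      show "scale_measure (ennreal (\<alpha> n)) (\<eta> n) \<le> Q x"
        by (subst le_measure) (auto simp: le_fun_def mino that emeasure_notin_sets)
    qed simp
    finally show ?thesis by (simp add: ennreal_P h)
  qed
  \<comment> \<open>An infinite \<open>e\<close> would lie below the finite value
    \<open>P h x\<close> at any \<open>x\<close> in \<open>K n\<close>; then \<open>K n\<close> is
    empty and any positive constant serves.\<close>
  define c where "c = (if e = \<top> then 1 else enn2real e)"
  have "c > 0" using \<open>e \<noteq> 0\<close> by (auto simp: c_def enn2real_positive_iff zero_less_iff_neq_zero less_top)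
  moreover have "c \<le> P h x" if "x \<in> K n" for x
  proof -
    have "e \<noteq> \<top>" using e_le[OF that] by (auto simp: top_unique)
    then show ?thesis
      using e_le[OF that] enn2real_mono[of e "ennreal (P h x)"] by (simp add: c_def P_nonneg h)
  qed
  ultimately show ?thesis using n by blast
qed

lemma measure_K_eventually_pos:
  assumes "\<mu> \<in> prob_measures"
  shows "\<exists>N. \<forall>n\<ge>N. 0 < measure \<mu> (K n)"
proof -
  interpret prob_space \<mu> using assms by (simp add: prob_measures_def)
  have s: "sets \<mu> = sets borel" using assms by (simp add: prob_measures_def)
  have "(\<lambda>n. measure \<mu> (K n)) \<longlonglongrightarrow> measure \<mu> (\<Union>n. K n)"
    by (rule finite_Lim_measure_incseq) (use K_mono in \<open>auto simp: s incseq_def\<close>)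
  moreover have "(\<Union>n. K n) = space \<mu>"
    using K_cover sets_eq_imp_space_eq[OF s] by auto
  ultimately have "(\<lambda>n. measure \<mu> (K n)) \<longlonglongrightarrow> 1" by (simp add: prob_space)
  from order_tendstoD(1)[OF this, of 0] show ?thesis by (simp add: eventually_sequentially)
qed

text \<open>The Lyapunov condition and a subeigenfunction bounded below on a large compact set control
  \<^term>\<open>(P ^^ k) W\<close> by \<^term>\<open>(P ^^ k) h\<close>. Since \<^term>\<open>h\<close> is negligible with respect to
  \<^term>\<open>W\<close> outside of compact sets, this control forces \<^term>\<open>(P ^^ k) (\<lambda>_. 1)\<close> to be comparable
  to \<^term>\<open>(P ^^ k) h\<close>.\<close>

lemma iterates_one_lower_bound:
  assumes r: "0 < r" and h: "h \<in> cone" and sub: "\<And>x. r * h x \<le> P h x"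
    and below: "\<And>n0. \<exists>n\<ge>n0. \<exists>c>0. \<forall>x\<in>K n. c \<le> h x"
    and \<mu>: "\<mu> \<in> prob_measures" "(\<integral>\<^sup>+x. ennreal (W x) \<partial>\<mu>) < \<infinity>"
  shows "\<exists>c>0. \<forall>\<^sub>F k in sequentially. c * r ^ k \<le> (\<integral>x. (P ^^ k) (\<lambda>_. 1) x \<partial>\<mu>)"
proof -
  interpret prob_space \<mu> using \<mu> by (simp add: prob_measures_def)
  have sets_\<mu> [simp, measurable_cong]: "sets \<mu> = sets borel" using \<mu> by (simp add: prob_measures_def)
  note int = cone_integrable[OF sets_\<mu> \<mu>(2)]
  obtain N1 where N1: "\<And>n. n \<ge> N1 \<Longrightarrow> \<gamma> n < r" using \<gamma>_eventually_small[OF r] by blast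
  obtain N2 where N2: "\<And>n. n \<ge> N2 \<Longrightarrow> 0 < measure \<mu> (K n)"
    using measure_K_eventually_pos[OF \<mu>(1)] by blast
  obtain n c where n: "n \<ge> max N1 N2" and c: "c > 0" "\<And>x. x \<in> K n \<Longrightarrow> c \<le> h x"
    using below by blast
  define g where "g = \<gamma> n"
  have g: "0 < g" "g < r" using N1[of n] n \<gamma>_pos[of n] by (auto simp: g_def)
  \<comment> \<open>\<open>D\<close> is the solution of \<open>(g * D + b n / c) / r = D\<close>,
    which closes the induction for \<open>PkW\<close>.\<close>
  define D where "D = b n / (c * (r - g))"
  have D: "D > 0" using b_pos[of n] c g by (simp add: D_def)
  have D_eq: "(g * D + b n / c) * (1 / r) = D" using c g r by (simp add: D_def field_simps)
  have Pk_h_le: "(P ^^ k) h x \<le> (1 / r) * (P ^^ Suc k) h x" for k x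
    unfolding funpow_Suc_right o_def using r sub
    by (intro Pk_mono h P_cone) (auto simp: field_simps)
  have PkW: "(P ^^ k) W x \<le> g ^ k * W x + D * (P ^^ k) h x" for k x
  proof (induction k arbitrary: x)
    case 0
    then show ?case using D coneD(2)[OF h, of x] by simp
  next
    case (Suc k)
    \<comment> \<open>On \<open>K n\<close> one has \<open>c\<close> at most \<open>h\<close>, so
      the indicator in the Lyapunov bound is dominated by \<open>h / c\<close>.\<close>
    have "P W x \<le> g * W x + (b n / c) * h x" for x
    proof -
      have "b n * indicator (K n) x \<le> (b n / c) * h x"
        using b_pos[of n] c coneD(2)[OF h, of x] by (auto simp: field_simps split: split_indicator)
      then show ?thesis using P_W_le[of x n] by (simp add: g_def)
    qed
    then have "(P ^^ Suc k) W x \<le> g * (P ^^ k) W x + (b n / c) * (P ^^ k) h x"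
      unfolding funpow_Suc_right o_def using g b_pos[of n] c
      by (intro Pk_lincomb_le P_cone h cone_W) auto
    also have "\<dots> \<le> g * (g ^ k * W x + D * (P ^^ k) h x) + (b n / c) * (P ^^ k) h x"
      using Suc.IH g by (intro add_right_mono mult_left_mono) auto
    also have "\<dots> = g ^ Suc k * W x + (g * D + b n / c) * (P ^^ k) h x"
      by (simp add: algebra_simps)
    also have "(g * D + b n / c) * (P ^^ k) h x \<le> (g * D + b n / c) * ((1 / r) * (P ^^ Suc k) h x)"
      using g D b_pos[of n] c by (intro mult_left_mono Pk_h_le) auto
    also have "\<dots> = D * (P ^^ Suc k) h x"
      by (simp only: mult.assoc[symmetric] D_eq)
    finally show ?case by simp
  qed
  \<comment> \<open>From \<open>r * h\<close> at most \<open>P h\<close>, hence at most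
    \<open>C * P W\<close>, a Lyapunov bound with \<open>\<gamma> m\<close> small yields any
    prescribed coefficient of \<open>W\<close>. The value \<open>1 / (2 * D)\<close> is chosen so
    that inserting \<open>PkW\<close> returns only half of \<open>(P ^^ k) h\<close>, which is then
    absorbed.\<close>
  obtain B where B: "B > 0" "\<And>x. h x \<le> 1 / (2 * D) * W x + B * 1"
  proof -
    obtain C where C: "C > 0" "\<And>x. h x \<le> C * W x" using h cone_bound by metis
    obtain m where m: "\<gamma> m < r / (2 * D * C)"
      using \<gamma>_eventually_small[of "r / (2 * D * C)"] r D C by auto
    have "h x \<le> 1 / (2 * D) * W x + (C * b m / r) * 1" for x
    proof -
      have "r * h x \<le> C * P W x"
        using sub[of x] Pk_mono[OF h cone_W, of C 1 x] C by simp
      also have "\<dots> \<le> C * (\<gamma> m * W x + b m)"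
      proof (rule mult_left_mono)
        have "b m * indicator (K m) x \<le> b m"
          using b_pos[of m] by (auto split: split_indicator)
        then show "P W x \<le> \<gamma> m * W x + b m" using P_W_le[of x m] by simp
      qed (use C in simp)
      finally have "h x \<le> (C * \<gamma> m / r) * W x + C * b m / r" using r by (simp add: field_simps)
      moreover have "(C * \<gamma> m / r) * W x \<le> 1 / (2 * D) * W x"
        using m C D r W_pos[of x] by (intro mult_right_mono) (auto simp: field_simps)
      ultimately show ?thesis by simp
    qed
    then show ?thesis using that[of "C * b m / r"] C b_pos[of m] r by simp
  qed
  have Pk_h_upper: "(P ^^ k) h x \<le> (1 / D) * (g ^ k * W x) + 2 * B * (P ^^ k) (\<lambda>_. 1) x" for k x
  proof -
    have "(P ^^ k) h x \<le> 1 / (2 * D) * (P ^^ k) W x + B * (P ^^ k) (\<lambda>_. 1) x"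
      using B D by (intro Pk_lincomb_le h cone_W cone_one) auto
    also have "1 / (2 * D) * (P ^^ k) W x \<le> 1 / (2 * D) * (g ^ k * W x + D * (P ^^ k) h x)"
      using D by (intro mult_left_mono PkW) auto
    also have "\<dots> = 1 / (2 * D) * (g ^ k * W x) + (P ^^ k) h x / 2"
      using D by (simp add: distrib_left)
    finally show ?thesis by (simp add: field_simps)
  qed
  have Pk_h_lower: "r ^ k * h x \<le> (P ^^ k) h x" for k x
  proof (induction k)
    case (Suc k)
    have "r ^ Suc k * h x \<le> r * (P ^^ k) h x" using Suc r by simp
    also have "\<dots> \<le> (P ^^ Suc k) h x" using Pk_h_le[of k x] r by (simp add: field_simps)
    finally show ?case .
  qed simp
  define a where "a = (\<integral>x. h x \<partial>\<mu>)"
  have "c * measure \<mu> (K n) = (\<integral>x. c * indicator (K n) x \<partial>\<mu>)" by simp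
  also have "\<dots> \<le> a"
    unfolding a_def using c coneD(2)[OF h]
    by (intro integral_mono int[OF h]) (auto split: split_indicator simp: emeasure_eq_measure)
  finally have a: "a > 0" using c N2[of n] n by (smt (verit) max.boundedE mult_pos_pos)
  define w where "w = (\<integral>x. W x \<partial>\<mu>)"
  have main: "r ^ k * a \<le> (1 / D) * (g ^ k * w) + 2 * B * (\<integral>x. (P ^^ k) (\<lambda>_. 1) x \<partial>\<mu>)" for k
  proof -
    have "r ^ k * a = (\<integral>x. r ^ k * h x \<partial>\<mu>)" by (simp add: a_def)
    also have "\<dots> \<le> (\<integral>x. (1 / D) * (g ^ k * W x) + 2 * B * (P ^^ k) (\<lambda>_. 1) x \<partial>\<mu>)"
      using order_trans[OF Pk_h_lower Pk_h_upper]
      by (intro integral_mono Bochner_Integration.integrable_add integrable_mult_right int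
            h cone_W cone_one Pk_cone)
    also have "\<dots> = (1 / D) * (g ^ k * w) + 2 * B * (\<integral>x. (P ^^ k) (\<lambda>_. 1) x \<partial>\<mu>)"
      by (subst Bochner_Integration.integral_add)
        (simp_all add: w_def int cone_W cone_one Pk_cone)
    finally show ?thesis .
  qed
  \<comment> \<open>Since \<open>g < r\<close>, the contribution of \<open>W\<close> is eventually
    at most half of \<open>r ^ k * a\<close>; the other half gives the constant
    \<open>a / (4 * B)\<close>.\<close>
  have "(\<lambda>k. (w / D) * (g / r) ^ k) \<longlonglongrightarrow> (w / D) * 0"
    using g by (intro tendsto_intros LIMSEQ_power_zero) auto
  then have "\<forall>\<^sub>F k in sequentially. (w / D) * (g / r) ^ k < a / 2"
    using a by (intro order_tendstoD(2)) auto
  then have "\<forall>\<^sub>F k in sequentially. a / (4 * B) * r ^ k \<le> (\<integral>x. (P ^^ k) (\<lambda>_. 1) x \<partial>\<mu>)"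
  proof eventually_elim
    case (elim k)
    have "r ^ k * ((w / D) * (g / r) ^ k) \<le> r ^ k * (a / 2)"
      using elim r by (intro mult_left_mono) auto
    then have "(1 / D) * (g ^ k * w) \<le> r ^ k * (a / 2)"
      using r by (simp add: power_divide field_simps)
    with main[of k] have "r ^ k * a \<le> 4 * B * (\<integral>x. (P ^^ k) (\<lambda>_. 1) x \<partial>\<mu>)"
      by (simp only: times_divide_eq_right)
    then show ?case using B by (simp add: field_simps)
  qed
  then show ?thesis using a B by (intro exI[of _ "a / (4 * B)"]) auto
qed

section \<open>The threshold rate of geometric boundedness\<close>

definition geometrically_bounded :: "real \<Rightarrow> bool" where
  "geometrically_bounded r \<longleftrightarrow> (\<exists>C. \<forall>k x. (P ^^ k) W x \<le> C * r ^ k * W x)"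

lemma iterates_one_lower_bound_if_unbounded:
  assumes r: "0 < r" and "\<not> geometrically_bounded r"
    and \<mu>: "\<mu> \<in> prob_measures" "(\<integral>\<^sup>+x. ennreal (W x) \<partial>\<mu>) < \<infinity>"
  shows "\<exists>c>0. \<forall>\<^sub>F k in sequentially. c * r ^ k \<le> (\<integral>x. (P ^^ k) (\<lambda>_. 1) x \<partial>\<mu>)"
proof -
  obtain h x0 where h: "h \<in> cone" "0 < h x0" and sub: "\<And>x. r * h x \<le> P h x"
    using subeigenfunction_exists[OF r] assms(2) unfolding geometrically_bounded_def by blast
  have pos: "0 < P h x0" using sub[of x0] h r by (meson less_le_trans mult_pos_pos)
  show ?thesis
  proof (rule iterates_one_lower_bound[OF r P_cone[OF h(1)] _ _ \<mu>])
    show "r * P h x \<le> P (P h) x" for x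
      using P_mono[OF cone_cmult[OF h(1)] P_cone[OF h(1)] sub, of x] r by (simp add: P_cmult)
    show "\<exists>n\<ge>n0. \<exists>c>0. \<forall>x\<in>K n. c \<le> P h x" for n0
      by (rule P_bounded_below_on_compact[OF h(1) pos])
  qed
qed

lemma geometrically_bounded_mono:
  assumes "geometrically_bounded r" "0 \<le> r" "r \<le> s"
  shows "geometrically_bounded s"
proof -
  obtain C where C: "\<And>k x. (P ^^ k) W x \<le> C * r ^ k * W x"
    using assms by (auto simp: geometrically_bounded_def)
  \<comment> \<open>The case \<open>k = 0\<close> fixes the sign of \<open>C\<close>, needed to
    multiply inequalities by it.\<close>
  have "1 \<le> C" using C[of 0 undefined] W_pos[of undefined] by simp
  then have "C * r ^ k * W x \<le> C * s ^ k * W x" for k x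
    using assms W_pos[of x] by (intro mult_right_mono mult_left_mono power_mono) auto
  then show ?thesis using C unfolding geometrically_bounded_def by (meson order_trans)
qed

lemma geometrically_bounded_exists: "\<exists>r>0. geometrically_bounded r"
proof (intro exI conjI)
  let ?r = "\<gamma> 0 + b 0"
  show r: "?r > 0" using \<gamma>_pos[of 0] b_pos[of 0] by simp
  have "(P ^^ k) W x \<le> ?r ^ k * W x" for k x
  proof (induction k)
    case (Suc k)
    have "(P ^^ Suc k) W x \<le> ?r * (P ^^ k) W x"
      unfolding funpow_Suc_right o_def using r P_W_le_W by (intro Pk_mono P_cone cone_W) auto
    also have "\<dots> \<le> ?r * (?r ^ k * W x)" using Suc r by (intro mult_left_mono) auto
    finally show ?case by simp
  qed simp
  then show "geometrically_bounded ?r"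
    unfolding geometrically_bounded_def by (intro exI[of _ 1]) simp
qed

text \<open>This will be the spectral radius. As the threshold of the dichotomy, it is available
  before the limit defining the spectral radius is known to exist.\<close>

definition growth_rate :: real where
  "growth_rate = Inf {r. 0 < r \<and> geometrically_bounded r}"

lemma growth_rate_nonneg: "0 \<le> growth_rate"
  unfolding growth_rate_def using geometrically_bounded_exists by (intro cInf_greatest) auto

lemma geometrically_bounded_above_growth_rate:
  assumes "growth_rate < r"
  shows "geometrically_bounded r"
proof -
  obtain s where "0 < s" "geometrically_bounded s" "s < r"
    using cInf_lessD[OF _ assms[unfolded growth_rate_def]] geometrically_bounded_exists by auto
  then show ?thesis using geometrically_bounded_mono[of s r] by simp
qed

lemma not_geometrically_bounded_below_growth_rate:
  assumes "0 < r" "r < growth_rate"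
  shows "\<not> geometrically_bounded r"
proof
  assume "geometrically_bounded r"
  then have "growth_rate \<le> r"
    unfolding growth_rate_def using assms by (intro cInf_lower bdd_belowI[of _ 0]) auto
  with assms show False by simp
qed

section \<open>Root asymptotics of operator norms and total masses\<close>

lemma integral_iterates_one_le:
  assumes \<mu>: "\<mu> \<in> prob_measures" "(\<integral>\<^sup>+x. ennreal (W x) \<partial>\<mu>) < \<infinity>"
  shows "(\<integral>x. (P ^^ k) (\<lambda>_. 1) x \<partial>\<mu>) \<le> opnormW Q W k * (\<integral>x. W x \<partial>\<mu>)"
proof -
  have sets_\<mu>: "sets \<mu> = sets borel" using \<mu> by (simp add: prob_measures_def)
  note int = cone_integrable[OF sets_\<mu> \<mu>(2)]
  have "(\<integral>x. (P ^^ k) (\<lambda>_. 1) x \<partial>\<mu>) \<le> (\<integral>x. opnormW Q W k * W x \<partial>\<mu>)"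
  proof (intro integral_mono int Pk_cone cone_one cone_cmult cone_W)
    show "(P ^^ k) (\<lambda>_. 1) x \<le> opnormW Q W k * W x" for x
      using Pk_mono[OF cone_one cone_W, of 1 k x] W_ge_1 le_wnorm[OF Pk_cone[OF cone_W], of k x]
      by (simp add: opnormW_eq)
    show "0 \<le> opnormW Q W k" by (simp add: opnormW_eq wnorm_nonneg Pk_cone cone_W)
  qed
  then show ?thesis by simp
qed

lemma opnormW_upper_bound:
  assumes "growth_rate < r"
  shows "\<exists>C\<ge>0. \<forall>k. opnormW Q W k \<le> C * r ^ k"
proof -
  obtain C where C: "\<And>k x. (P ^^ k) W x \<le> C * r ^ k * W x"
    using geometrically_bounded_above_growth_rate[OF assms] by (auto simp: geometrically_bounded_def)
  have "1 \<le> C" using C[of 0 undefined] W_pos[of undefined] by simp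
  moreover have "opnormW Q W k \<le> C * r ^ k" for k
    unfolding opnormW_eq using C Pk_nonneg[OF cone_W] by (intro wnorm_le) auto
  ultimately show ?thesis by (intro exI[of _ C]) auto
qed

lemma integral_W_ge_1:
  assumes "\<mu> \<in> prob_measures" "(\<integral>\<^sup>+x. ennreal (W x) \<partial>\<mu>) < \<infinity>"
  shows "1 \<le> (\<integral>x. W x \<partial>\<mu>)"
proof -
  interpret prob_space \<mu> using assms by (simp add: prob_measures_def)
  have "sets \<mu> = sets borel" using assms by (simp add: prob_measures_def)
  from integral_mono[OF cone_integrable[OF this assms(2) cone_one]
      cone_integrable[OF this assms(2) cone_W]] W_ge_1
  show ?thesis by (simp add: prob_space)
qed

text \<open>Existence of the limit comes from two-sided geometric bounds, not from subadditivity.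
  The lower bound is inherited from \<open>\<mu>\<close>, because the total masses are at most the
  operator norm times the finite integral of \<open>W\<close>.\<close>

lemma opnormW_root_tendsto:
  assumes \<mu>: "\<mu> \<in> prob_measures" "(\<integral>\<^sup>+x. ennreal (W x) \<partial>\<mu>) < \<infinity>"
  shows "(\<lambda>k. opnormW Q W k powr (1 / real k)) \<longlonglongrightarrow> growth_rate"
proof (rule tendsto_root_of_geometric_bounds)
  show "0 \<le> opnormW Q W k" for k by (simp add: opnormW_eq wnorm_nonneg Pk_cone cone_W)
  show "0 \<le> growth_rate" by (rule growth_rate_nonneg)
  show "\<exists>C. \<forall>\<^sub>F k in sequentially. opnormW Q W k \<le> C * r ^ k" if "growth_rate < r" for r
    using opnormW_upper_bound[OF that] by (auto intro: always_eventually)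
  show "\<exists>c>0. \<forall>\<^sub>F k in sequentially. c * r ^ k \<le> opnormW Q W k" if r: "0 < r" "r < growth_rate" for r
  proof -
    let ?w = "\<integral>x. W x \<partial>\<mu>"
    have w: "1 \<le> ?w" by (rule integral_W_ge_1[OF \<mu>])
    obtain c where c: "c > 0" "\<forall>\<^sub>F k in sequentially. c * r ^ k \<le> (\<integral>x. (P ^^ k) (\<lambda>_. 1) x \<partial>\<mu>)"
      using iterates_one_lower_bound_if_unbounded[OF r(1) _ \<mu>]
        not_geometrically_bounded_below_growth_rate[OF r] by blast
    from c(2) have "\<forall>\<^sub>F k in sequentially. c / ?w * r ^ k \<le> opnormW Q W k"
    proof eventually_elim
      case (elim k)
      then have "c * r ^ k \<le> opnormW Q W k * ?w" using integral_iterates_one_le[OF \<mu>, of k] by simp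
      then show ?case using w by (simp add: field_simps)
    qed
    then show ?thesis using c w by (intro exI[of _ "c / ?w"]) auto
  qed
qed

lemma iterates_one_root_tendsto:
  assumes \<mu>: "\<mu> \<in> prob_measures" "(\<integral>\<^sup>+x. ennreal (W x) \<partial>\<mu>) < \<infinity>"
  shows "(\<lambda>k. (\<integral>x. (P ^^ k) (\<lambda>_. 1) x \<partial>\<mu>) powr (1 / real k)) \<longlonglongrightarrow> growth_rate"
proof (rule tendsto_root_of_geometric_bounds)
  show "0 \<le> (\<integral>x. (P ^^ k) (\<lambda>_. 1) x \<partial>\<mu>)" for k by (simp add: Pk_nonneg cone_one)
  show "0 \<le> growth_rate" by (rule growth_rate_nonneg)
  show "\<exists>C. \<forall>\<^sub>F k in sequentially. (\<integral>x. (P ^^ k) (\<lambda>_. 1) x \<partial>\<mu>) \<le> C * r ^ k"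
    if r: "growth_rate < r" for r
  proof -
    let ?w = "\<integral>x. W x \<partial>\<mu>"
    obtain C where C: "\<And>k. opnormW Q W k \<le> C * r ^ k" using opnormW_upper_bound[OF r] by blast
    have "(\<integral>x. (P ^^ k) (\<lambda>_. 1) x \<partial>\<mu>) \<le> (C * ?w) * r ^ k" for k
    proof -
      have "opnormW Q W k * ?w \<le> C * r ^ k * ?w"
        using C integral_W_ge_1[OF \<mu>] by (intro mult_right_mono) auto
      then show ?thesis using integral_iterates_one_le[OF \<mu>, of k] by (simp add: mult_ac)
    qed
    then show ?thesis by (auto intro: always_eventually)
  qed
  show "\<exists>c>0. \<forall>\<^sub>F k in sequentially. c * r ^ k \<le> (\<integral>x. (P ^^ k) (\<lambda>_. 1) x \<partial>\<mu>)"
    if r: "0 < r" "r < growth_rate" for r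
    using iterates_one_lower_bound_if_unbounded[OF r(1) _ \<mu>]
      not_geometrically_bounded_below_growth_rate[OF r] by blast
qed

text \<open>A fixed point is a left eigenmeasure: integrating \<open>P f\<close> multiplies the
  integral of \<open>f\<close> by a fixed factor. Starting from the constant one, this repeats
  \<open>k\<close> times.\<close>

lemma FK_fixed_point_iterates:
  assumes \<mu>: "\<mu> \<in> prob_measures" "(\<integral>\<^sup>+x. ennreal (W x) \<partial>\<mu>) < \<infinity>" and fixed: "FK_map Q \<mu> = \<mu>"
  shows "(\<integral>x. (P ^^ k) (\<lambda>_. 1) x \<partial>\<mu>) = (\<integral>x. P (\<lambda>_. 1) x \<partial>\<mu>) ^ k"
proof -
  interpret prob_space \<mu> using \<mu> by (simp add: prob_measures_def)
  have sets_\<mu> [simp, measurable_cong]: "sets \<mu> = sets borel" using \<mu> by (simp add: prob_measures_def)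
  note int = cone_integrable[OF sets_\<mu> \<mu>(2)]
  have nn: "(\<integral>\<^sup>+x. ennreal (f x) \<partial>\<mu>) = ennreal (\<integral>x. f x \<partial>\<mu>)" if "f \<in> cone" for f
    using nn_integral_eq_integral[OF int[OF that]] coneD(2)[OF that] by simp
  let ?m = "\<integral>x. P (\<lambda>_. 1) x \<partial>\<mu>"
  have m: "0 \<le> ?m" by (simp add: P_nonneg cone_one)
  have "emeasure (Q x) UNIV = ennreal (P (\<lambda>_. 1) x)" for x
    by (simp add: ennreal_P cone_one)
  then have D: "(\<integral>\<^sup>+x. emeasure (Q x) UNIV \<partial>\<mu>) = ennreal ?m"
    by (simp add: nn P_cone cone_one)
  have step: "(\<integral>x. P f x \<partial>\<mu>) = ?m * (\<integral>x. f x \<partial>\<mu>)" if f: "f \<in> cone" for f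
  proof -
    note [measurable] = coneD(1)[OF f]
    have "ennreal (\<integral>x. P f x \<partial>\<mu>) = (\<integral>\<^sup>+x. \<integral>\<^sup>+y. ennreal (f y) \<partial>Q x \<partial>\<mu>)"
      by (simp add: ennreal_P f P_cone flip: nn)
    also have "\<dots> = ennreal ?m * (\<integral>\<^sup>+x. ennreal (f x) \<partial>\<mu>)"
      using FK_fixed_point_eigenmeasure[OF \<mu>(1) fixed] D
      by (intro nn_integral_kernel_eigenmeasure) auto
    also have "\<dots> = ennreal (?m * (\<integral>x. f x \<partial>\<mu>))"
      using m by (simp add: nn f ennreal_mult')
    finally show ?thesis
      using m coneD(2)[OF f] by (subst (asm) ennreal_inj) (auto simp: P_nonneg f)
  qed
  show ?thesis
  proof (induction k)
    case 0
    then show ?case by (simp add: prob_space)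
  next
    case (Suc k)
    then show ?case using step[OF Pk_cone[OF cone_one], of k] by simp
  qed
qed

end

theorem theorem2:
  fixes Q :: "'a::polish_space \<Rightarrow> 'a measure"
    and K :: "nat \<Rightarrow> 'a set"
    and W :: "'a \<Rightarrow> real"
    and \<gamma> b \<alpha> :: "nat \<Rightarrow> real"
    and \<eta> :: "nat \<Rightarrow> 'a measure"
    and \<Lambda> :: real
    and \<mu>star \<mu> :: "'a measure"
  assumes "kernel_operator Q"
    and "compact_exhaustion K"
    and "lyapunov_assm Q K W \<gamma> b"
    and "minorization_assm Q K W \<eta> \<alpha>"
    and "regularity_assm Q K"
    and "\<Lambda> = spectral_radiusW Q W" and "\<Lambda> > 0"
    and "\<mu>star \<in> prob_measures" and "(\<integral>\<^sup>+x. ennreal (W x) \<partial>\<mu>star) < \<infinity>"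
    and "FK_map Q \<mu>star = \<mu>star"
    and "\<And>\<nu>. \<nu> \<in> prob_measures \<Longrightarrow> (\<integral>\<^sup>+x. ennreal (W x) \<partial>\<nu>) < \<infinity> \<Longrightarrow>
           FK_map Q \<nu> = \<nu> \<Longrightarrow> \<nu> = \<mu>star"
    and "\<mu> \<in> prob_measures" and "(\<integral>\<^sup>+x. ennreal (W x) \<partial>\<mu>) < \<infinity>"
  shows "((\<lambda>k. ln (\<integral>x. (Qop Q ^^ k) (\<lambda>_. 1) x \<partial>\<mu>) / real k) \<longlonglongrightarrow> ln \<Lambda>) \<and>
         \<Lambda> = (\<integral>x. Qop Q (\<lambda>_. 1) x \<partial>\<mu>star)"
proof -
  interpret feynman_kac_kernel Q K W \<gamma> b \<eta> \<alpha>
    using assms(1-5) by unfold_locales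
  \<comment> \<open>\<open>lim\<close> is meaningful only after convergence is proved;
    \<open>\<mu>star\<close> serves as the admissible measure for that.\<close>
  have \<Lambda>: "\<Lambda> = growth_rate"
    using limI[OF opnormW_root_tendsto[OF assms(8,9)]] assms(6) by (simp add: spectral_radiusW_def)
  show ?thesis
  proof
    let ?z = "\<lambda>k. \<integral>x. (P ^^ k) (\<lambda>_. 1) x \<partial>\<mu>"
    \<comment> \<open>Positivity of \<open>\<Lambda>\<close> allows the logarithm to pass to the
      limit.\<close>
    have "(\<lambda>k. ln (?z k powr (1 / real k))) \<longlonglongrightarrow> ln \<Lambda>"
      using iterates_one_root_tendsto[OF assms(12,13)] assms(7) unfolding \<Lambda>
      by (intro tendsto_ln) auto
    then show "(\<lambda>k. ln (?z k) / real k) \<longlonglongrightarrow> ln \<Lambda>"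
      by (simp add: ln_powr)
  next
    let ?m = "\<integral>x. P (\<lambda>_. 1) x \<partial>\<mu>star"
    have m: "0 \<le> ?m" by (simp add: P_nonneg cone_one)
    \<comment> \<open>The roots are constant except at index \<open>0\<close>, where the exponent
      \<open>1 / real k\<close> is \<open>0\<close>. A zero mass is treated separately, since
      \<open>powr_realpow\<close> needs a positive base.\<close>
    have "\<forall>\<^sub>F k in sequentially. (?m ^ k) powr (1 / real k) = ?m"
      using eventually_gt_at_top[of 0]
    proof eventually_elim
      case (elim k)
      then show ?case using m
        by (cases "?m = 0") (auto simp: powr_powr simp flip: powr_realpow)
    qed
    moreover have "(\<lambda>k. (?m ^ k) powr (1 / real k)) \<longlonglongrightarrow> \<Lambda>"
      using iterates_one_root_tendsto[OF assms(8,9)] FK_fixed_point_iterates[OF assms(8-10)]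
      by (simp add: \<Lambda>)
    ultimately have "(\<lambda>k. ?m) \<longlonglongrightarrow> \<Lambda>"
      using tendsto_cong by fastforce
    then show "\<Lambda> = ?m" using LIMSEQ_unique[OF tendsto_const] by metis
  qed
qed

end
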